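(* Let $\mathcal{B}_1,\mathcal{B}_2\in\mathcal{L}^q$ and $\Phi_1,\Phi_2\in\mathbb{R}_s^{q\times q}[\zeta,\eta]$. Suppose that, for $i=1,2$, there is a storage function $Q_{\Psi_i}$ for $(\mathcal{B}_i,Q_{\Phi_i})$, with $\Psi_i\in\mathbb{R}_s^{q\times q}[\zeta,\eta]$. Define $\mathcal{B}:=\mathcal{B}_1\cap\mathcal{B}_2$ and assume that there exist scalars $\alpha_1>0$ and $\alpha_2\ge 0$, and $\Gamma\in\mathbb{R}_s^{q\times q}[\zeta,\eta]$, such that $$\frac{d}{dt}Q_\Gamma\stackrel{\mathcal{B}}{\geq}\alpha_1Q_{\Phi_1}+\alpha_2Q_{\Phi_2}.$$ Then: (i) $\mathcal{B}$ is stable if $\alpha_1Q_{\Psi_1}+\alpha_2Q_{\Psi_2}-Q_\Gamma\stackrel{\mathcal{B}}{>}0$; (ii) $\mathcal{B}$ is asymptotically stable if $Q_{\Psi_1}$ satisfies the dissipation inequality strictly (that is, $\frac{d}{dt}Q_{\Psi_1}\stackrel{\mathcal{B}_1}{<}Q_{\Phi_1}$) and $\alpha_1Q_{\Psi_1}+\alpha_2Q_{\Psi_2}-Q_\Gamma\stackrel{\mathcal{B}}{\geq}0$.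
   Context: Behaviors. $\mathcal{L}^q$ is the set of all $\mathcal{B}\subseteq\mathcal{C}^\infty(\mathbb{R},\mathbb{R}^q)$ of the form $\mathcal{B}=\{w\in\mathcal{C}^\infty(\mathbb{R},\mathbb{R}^q)\mid R(\frac{d}{dt})w=0\}$ for some real polynomial matrix $R\in\mathbb{R}^{p\times q}[\xi]$ (some $p$). Quadratic differential forms (QDFs). $\mathbb{R}_s^{q\times q}[\zeta,\eta]$ is the set of symmetric two-variable real polynomial matrices $\Phi(\zeta,\eta)=\sum_{k,l=0}^N\Phi_{kl}\zeta^k\eta^l$ with $\Phi_{kl}\in\mathbb{R}^{q\times q}$ and $\Phi_{kl}=\Phi_{lk}^\top$ for all $k,l$. Such $\Phi$ induces the QDF $Q_\Phi:\mathcal{C}^\infty(\mathbb{R},\mathbb{R}^q)\to\mathcal{C}^\infty(\mathbb{R},\mathbb{R})$, $(Q_\Phi(w))(t)=\sum_{k,l=0}^N\left(\frac{d^kw}{dt^k}(t)\right)^\top\Phi_{kl}\left(\frac{d^lw}{dt^l}(t)\right)$. The derivative $\frac{d}{dt}Q_\Phi$ is the map $w\mapsto\frac{d}{dt}(Q_\Phi(w))$, which is again a QDF, induced by $(\zeta+\eta)\Phi(\zeta,\eta)$. Sign conditions on a behavior. For $\mathcal{B}\in\mathcal{L}^q$: $Q_\Phi\stackrel{\mathcal{B}}{\geq}0$ means $(Q_\Phi(w))(t)\ge 0$ for all $w\in\mathcal{B}$ and all $t\in\mathbb{R}$. $Q_\Phi\stackrel{\mathcal{B}}{>}0$ means $Q_\Phi\stackrel{\mathcal{B}}{\geq}0$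 and the only $w\in\mathcal{B}$ for which $Q_\Phi(w)$ is identically zero (for all $t\in\mathbb{R}$) is $w=0$. For two QDFs, $Q\stackrel{\mathcal{B}}{\leq}Q'$ means $Q'-Q\stackrel{\mathcal{B}}{\geq}0$ and $Q\stackrel{\mathcal{B}}{<}Q'$ means $Q'-Q\stackrel{\mathcal{B}}{>}0$. Storage functions. $Q_\Psi$ is a storage function for $(\mathcal{B},Q_\Phi)$ if the dissipation inequality $\frac{d}{dt}Q_\Psi\stackrel{\mathcal{B}}{\leq}Q_\Phi$ holds; it satisfies the dissipation inequality strictly if $\frac{d}{dt}Q_\Psi\stackrel{\mathcal{B}}{<}Q_\Phi$. No sign condition on $Q_\Psi$ is required. Stability. $\mathcal{B}\in\mathcal{L}^q$ is autonomous if whenever $w_1,w_2\in\mathcal{B}$ satisfy $w_1(t)=w_2(t)$ for all $t<0$, then $w_1=w_2$. An autonomous $\mathcal{B}$ is stable if every $w\in\mathcal{B}$ is bounded on $[0,\infty)$, and asymptotically stable if $\lim_{t\to\infty}w(t)=0$ for all $w\in\mathcal{B}$. The assertion that $\mathcal{B}$ is stable (asymptotically stable) is understood to include that $\mathcal{B}$ is autonomous. *)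

theory Defs
  imports "HOL-Analysis.Analysis" "HOL-Computational_Algebra.Polynomial"
begin

definition ddt :: "(real \<Rightarrow> 'a::real_normed_vector) \<Rightarrow> real \<Rightarrow> 'a" where
  "ddt w = (\<lambda>t. vector_derivative w (at t))"

definition smooth :: "(real \<Rightarrow> 'a::real_normed_vector) \<Rightarrow> bool" where
  "smooth w \<longleftrightarrow> (\<forall>k t. (ddt ^^ k) w differentiable (at t))"

definition poly_ddt :: "real poly \<Rightarrow> (real \<Rightarrow> real) \<Rightarrow> real \<Rightarrow> real" where
  "poly_ddt P f = (\<lambda>t. \<Sum>k\<le>degree P. coeff P k * (ddt ^^ k) f t)"

text \<open>
  The number of rows of the polynomial matrix is existentially quantified, so a matrix with
  \<open>p\<close> rows is given by its rows \<open>R i\<close> for \<open>i < p\<close>. Row \<open>i\<close> of \<open>R(d/dt) w\<close> is the sum below.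
\<close>

definition kernel_behavior :: "nat \<Rightarrow> (nat \<Rightarrow> real poly ^ 'q) \<Rightarrow> (real \<Rightarrow> real ^ 'q) set" where
  "kernel_behavior p R =
    {w. smooth w \<and> (\<forall>i<p. \<forall>t. (\<Sum>j\<in>UNIV. poly_ddt (R i $ j) (\<lambda>s. w s $ j) t) = 0)}"

definition linear_behaviors :: "(real \<Rightarrow> real ^ 'q) set set" where
  "linear_behaviors = {B. \<exists>p R. B = kernel_behavior p R}"

text \<open>
  A two-variable polynomial matrix is a nested polynomial with matrix coefficients: the
  coefficient of \<open>\<zeta>^k \<eta>^l\<close> is \<open>coeff (coeff \<Phi> k) l\<close>.
\<close>

type_synonym 'q poly2_mat = "(real ^ 'q ^ 'q) poly poly"

definition coeff2 :: "'q::finite poly2_mat \<Rightarrow> nat \<Rightarrow> nat \<Rightarrow> real ^ 'q ^ 'q" where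
  "coeff2 \<Phi> k l = coeff (coeff \<Phi> k) l"

definition symmetric2 :: "'q::finite poly2_mat \<Rightarrow> bool" where
  "symmetric2 \<Phi> \<longleftrightarrow> (\<forall>k l. coeff2 \<Phi> k l = transpose (coeff2 \<Phi> l k))"

type_synonym 'q signal_map = "(real \<Rightarrow> real ^ 'q) \<Rightarrow> real \<Rightarrow> real"

definition QDF :: "'q::finite poly2_mat \<Rightarrow> 'q signal_map" where
  "QDF \<Phi> w = (\<lambda>t. \<Sum>k\<le>degree \<Phi>. \<Sum>l\<le>degree (coeff \<Phi> k).
     (ddt ^^ k) w t \<bullet> (coeff2 \<Phi> k l *v (ddt ^^ l) w t))"

definition ddt_map :: "'q::finite signal_map \<Rightarrow> 'q signal_map" where
  "ddt_map Q w = ddt (Q w)"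

definition nonneg_on :: "(real \<Rightarrow> real ^ 'q) set \<Rightarrow> 'q::finite signal_map \<Rightarrow> bool" where
  "nonneg_on B Q \<longleftrightarrow> (\<forall>w\<in>B. \<forall>t. 0 \<le> Q w t)"

definition pos_on :: "(real \<Rightarrow> real ^ 'q) set \<Rightarrow> 'q::finite signal_map \<Rightarrow> bool" where
  "pos_on B Q \<longleftrightarrow> nonneg_on B Q \<and> (\<forall>w\<in>B. (\<forall>t. Q w t = 0) \<longrightarrow> w = (\<lambda>t. 0))"

definition le_on :: "(real \<Rightarrow> real ^ 'q) set \<Rightarrow> 'q::finite signal_map \<Rightarrow> 'q signal_map \<Rightarrow> bool" where
  "le_on B Q Q' \<longleftrightarrow> nonneg_on B (\<lambda>w t. Q' w t - Q w t)"

definition less_on :: "(real \<Rightarrow> real ^ 'q) set \<Rightarrow> 'q::finite signal_map \<Rightarrow> 'q signal_map \<Rightarrow> bool" where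
  "less_on B Q Q' \<longleftrightarrow> pos_on B (\<lambda>w t. Q' w t - Q w t)"

definition storage_function ::
  "(real \<Rightarrow> real ^ 'q) set \<Rightarrow> 'q::finite poly2_mat \<Rightarrow> 'q poly2_mat \<Rightarrow> bool" where
  "storage_function B \<Phi> \<Psi> \<longleftrightarrow> le_on B (ddt_map (QDF \<Psi>)) (QDF \<Phi>)"

definition strictly_dissipative ::
  "(real \<Rightarrow> real ^ 'q) set \<Rightarrow> 'q::finite poly2_mat \<Rightarrow> 'q poly2_mat \<Rightarrow> bool" where
  "strictly_dissipative B \<Phi> \<Psi> \<longleftrightarrow> less_on B (ddt_map (QDF \<Psi>)) (QDF \<Phi>)"

definition autonomous :: "(real \<Rightarrow> real ^ 'q) set \<Rightarrow> bool" where
  "autonomous B \<longleftrightarrow> (\<forall>w1\<in>B. \<forall>w2\<in>B. (\<forall>t<0. w1 t = w2 t) \<longrightarrow> w1 = w2)"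

definition stable_behavior :: "(real \<Rightarrow> real ^ 'q) set \<Rightarrow> bool" where
  "stable_behavior B \<longleftrightarrow> autonomous B \<and> (\<forall>w\<in>B. bounded (w ` {0..}))"

definition asymptotically_stable :: "(real \<Rightarrow> real ^ 'q) set \<Rightarrow> bool" where
  "asymptotically_stable B \<longleftrightarrow> autonomous B \<and> (\<forall>w\<in>B. (w \<longlongrightarrow> 0) at_top)"

end

theory Submission
  imports Defs
begin

text \<open>
  The function \<open>V = \<alpha>1 Q\<^bsub>\<Psi>1\<^esub> + \<alpha>2 Q\<^bsub>\<Psi>2\<^esub> - Q\<^bsub>\<Gamma>\<^esub>\<close> is nonnegative and nonincreasing along \<open>B\<close>.
  A trajectory of the form \<open>e\<^sup>t x\<close> would make \<open>V\<close> a multiple of \<open>e\<^sup>2\<^sup>t\<close>, so \<open>V = 0\<close> on it and \<open>x = 0\<close>.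
  Hence the rows that annihilate \<open>B\<close>, evaluated at 1, span the whole space, and elimination gives a
  scalar equation \<open>p\<^sub>j(d/dt) w\<^sub>j = 0\<close> with \<open>p\<^sub>j(1) \<noteq> 0\<close> for each component. So finitely many initial
  values separate \<open>B\<close> and \<open>V(w)\<close> is real analytic. Consequently \<open>V(w)(0)\<close> in case (i), and
  \<open>V(w)(0) - V(w)(1)\<close> in case (ii), is a positive definite form on \<open>B\<close> that bounds \<open>\<bar>w(0)\<bar>\<^sup>2\<close>.
  Applied to the shifts of \<open>w\<close>, the first stays bounded by its value at 0 and the second tends to 0.
\<close>

section \<open>Iterated derivatives\<close>

lemma smooth_has_vector_derivative:
  assumes "smooth w"
  shows "((ddt ^^ k) w has_vector_derivative (ddt ^^ Suc k) w t) (at t)"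
proof -
  have "(ddt ^^ k) w differentiable (at t)"
    using assms by (simp add: smooth_def)
  then show ?thesis
    by (simp add: vector_derivative_works ddt_def)
qed

text \<open>The iterates of \<open>ddt\<close> follow by induction once a candidate for every order
  is known. Closed forms and smoothness for linear combinations, shifts, components and exponentials
  all come from this one criterion.\<close>

lemma iterated_ddt_eqI:
  assumes "\<And>t. d 0 t = w t"
    and "\<And>k t. (d k has_vector_derivative d (Suc k) t) (at t)"
  shows "(ddt ^^ k) w = d k" and "smooth w"
proof -
  have eq: "(ddt ^^ k) w = d k" for k
  proof (induction k)
    case 0
    then show ?case using assms(1) by auto
  next
    case (Suc k)
    then show ?case
      using assms(2) by (auto simp: ddt_def intro!: vector_derivative_at)
  qed
  then show "(ddt ^^ k) w = d k" by simp
  show "smooth w"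
    unfolding smooth_def eq using assms(2) by (auto intro: differentiableI_vector)
qed

lemma
  fixes u v :: "real \<Rightarrow> 'a::real_normed_vector"
  assumes "smooth u" "smooth v"
  shows iterated_ddt_lincomb: "(ddt ^^ k) (\<lambda>t. a *\<^sub>R u t + b *\<^sub>R v t)
      = (\<lambda>t. a *\<^sub>R (ddt ^^ k) u t + b *\<^sub>R (ddt ^^ k) v t)"
    and smooth_lincomb: "smooth (\<lambda>t. a *\<^sub>R u t + b *\<^sub>R v t)"
proof -
  let ?d = "\<lambda>k t. a *\<^sub>R (ddt ^^ k) u t + b *\<^sub>R (ddt ^^ k) v t"
  have "(?d k has_vector_derivative ?d (Suc k) t) (at t)" for k t
    using smooth_has_vector_derivative[OF assms(1), of k t]
      smooth_has_vector_derivative[OF assms(2), of k t]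
    by (intro has_vector_derivative_add bounded_linear.has_vector_derivative[OF bounded_linear_scaleR_right])
  then show "(ddt ^^ k) (\<lambda>t. a *\<^sub>R u t + b *\<^sub>R v t) = ?d k"
    and "smooth (\<lambda>t. a *\<^sub>R u t + b *\<^sub>R v t)"
    using iterated_ddt_eqI[of ?d "\<lambda>t. a *\<^sub>R u t + b *\<^sub>R v t"] by auto
qed

lemma
  fixes w :: "real \<Rightarrow> 'a::real_normed_vector"
  assumes "smooth w"
  shows iterated_ddt_shift: "(ddt ^^ k) (\<lambda>t. w (t + h)) = (\<lambda>t. (ddt ^^ k) w (t + h))"
    and smooth_shift: "smooth (\<lambda>t. w (t + h))"
proof -
  let ?d = "\<lambda>k t. (ddt ^^ k) w (t + h)"
  have "(?d k has_vector_derivative ?d (Suc k) t) (at t)" for k t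
  proof -
    have "((\<lambda>t. t + h) has_vector_derivative 1) (at t)"
      by (auto intro!: derivative_eq_intros)
    from vector_diff_chain_at[OF this smooth_has_vector_derivative[OF assms]] show ?thesis
      by (simp add: o_def)
  qed
  then show "(ddt ^^ k) (\<lambda>t. w (t + h)) = ?d k" and "smooth (\<lambda>t. w (t + h))"
    using iterated_ddt_eqI[of ?d "\<lambda>t. w (t + h)"] by auto
qed

lemma
  fixes w :: "real \<Rightarrow> real ^ 'q"
  assumes "smooth w"
  shows iterated_ddt_component: "(ddt ^^ k) (\<lambda>t. w t $ j) = (\<lambda>t. (ddt ^^ k) w t $ j)"
    and smooth_component: "smooth (\<lambda>t. w t $ j)"
proof -
  let ?d = "\<lambda>k t. (ddt ^^ k) w t $ j"
  have "(?d k has_vector_derivative ?d (Suc k) t) (at t)" for k t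
    using bounded_linear.has_vector_derivative[OF bounded_linear_vec_nth
      smooth_has_vector_derivative[OF assms, of k t]] .
  then show "(ddt ^^ k) (\<lambda>t. w t $ j) = ?d k" and "smooth (\<lambda>t. w t $ j)"
    using iterated_ddt_eqI[of ?d "\<lambda>t. w t $ j"] by auto
qed

lemma
  fixes x :: "'a::real_normed_vector"
  shows iterated_ddt_exp: "(ddt ^^ k) (\<lambda>t. exp t *\<^sub>R x) = (\<lambda>t. exp t *\<^sub>R x)"
    and smooth_exp: "smooth (\<lambda>t. exp t *\<^sub>R x)"
proof -
  have "((\<lambda>t. exp t *\<^sub>R x) has_vector_derivative exp t *\<^sub>R x) (at t)" for t :: real
  proof -
    have "((\<lambda>t. exp t *\<^sub>R x) has_vector_derivative exp t *\<^sub>R 0 + exp t *\<^sub>R x) (at t)"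
      by (intro has_vector_derivative_scaleR DERIV_exp has_vector_derivative_const)
    then show ?thesis by simp
  qed
  then show "(ddt ^^ k) (\<lambda>t. exp t *\<^sub>R x) = (\<lambda>t. exp t *\<^sub>R x)"
    and "smooth (\<lambda>t. exp t *\<^sub>R x)"
    using iterated_ddt_eqI[of "\<lambda>k t. exp t *\<^sub>R x" "\<lambda>t. exp t *\<^sub>R x"] by auto
qed

lemma smooth_has_real_derivative:
  assumes "smooth f"
  shows "((ddt ^^ k) f has_real_derivative (ddt ^^ Suc k) f t) (at t)"
  using smooth_has_vector_derivative[OF assms]
  by (simp add: has_real_derivative_iff_has_vector_derivative)

section \<open>Annihilating rows\<close>

lemma poly_ddt_eq_sum:
  assumes "degree P \<le> n"
  shows "poly_ddt P f t = (\<Sum>k\<le>n. coeff P k * (ddt ^^ k) f t)"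
  unfolding poly_ddt_def
  by (intro sum.mono_neutral_left) (use assms in \<open>auto simp: coeff_eq_0\<close>)

lemma poly_ddt_add: "poly_ddt (P + Q) f t = poly_ddt P f t + poly_ddt Q f t"
proof -
  define n where "n = max (degree P) (degree Q)"
  have "degree (P + Q) \<le> n" "degree P \<le> n" "degree Q \<le> n"
    by (auto simp: n_def degree_add_le_max)
  then show ?thesis
    by (simp add: poly_ddt_eq_sum[of _ n] sum.distrib algebra_simps)
qed

lemma poly_ddt_smult: "poly_ddt (smult a P) f t = a * poly_ddt P f t"
  by (simp add: poly_ddt_eq_sum[of _ "degree P"] sum_distrib_left algebra_simps)

lemma poly_ddt_0 [simp]: "poly_ddt 0 f t = 0"
  by (simp add: poly_ddt_def)

text \<open>\<open>pCons 0\<close> is multiplication by the indeterminate, which acts on signals as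
  differentiation.\<close>

lemma poly_ddt_has_derivative:
  assumes "smooth f"
  shows "(poly_ddt P f has_real_derivative poly_ddt (pCons 0 P) f t) (at t)"
proof -
  have "poly_ddt (pCons 0 P) f t = (\<Sum>k\<le>Suc (degree P). coeff (pCons 0 P) k * (ddt ^^ k) f t)"
    by (rule poly_ddt_eq_sum) (simp add: degree_pCons_le)
  also have "\<dots> = (\<Sum>k\<le>degree P. coeff P k * (ddt ^^ Suc k) f t)"
    by (subst sum.atMost_Suc_shift) simp
  finally show ?thesis
    unfolding poly_ddt_def
    using smooth_has_real_derivative[OF assms]
    by (auto intro!: derivative_eq_intros sum.cong simp del: funpow.simps)
qed

text \<open>Each derivative fixes the exponential, so the operator acts as its symbol evaluated at
  1. This is why 1 is the evaluation point below.\<close>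

lemma poly_ddt_exp: "poly_ddt P (\<lambda>t. exp t * c) t = poly P 1 * exp t * c"
  using iterated_ddt_exp[of _ c]
  by (simp add: poly_ddt_def poly_altdef sum_distrib_left mult_ac)

definition row_op :: "real poly ^ 'q \<Rightarrow> (real \<Rightarrow> real ^ 'q) \<Rightarrow> real \<Rightarrow> real" where
  "row_op r w t = (\<Sum>j\<in>UNIV. poly_ddt (r $ j) (\<lambda>s. w s $ j) t)"

definition solutions :: "(real poly ^ 'q) set \<Rightarrow> (real \<Rightarrow> real ^ 'q) set" where
  "solutions S = {w. smooth w \<and> (\<forall>r\<in>S. \<forall>t. row_op r w t = 0)}"

text \<open>All differential consequences of membership in \<open>B\<close>, not just a defining set
  of rows. For smooth trajectories they form a module over the polynomials, in which elimination can
  take place.\<close>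

definition annihilators :: "(real \<Rightarrow> real ^ 'q) set \<Rightarrow> (real poly ^ 'q) set" where
  "annihilators B = {r. \<forall>w\<in>B. \<forall>t. row_op r w t = 0}"

lemma solutions_smooth: "w \<in> solutions S \<Longrightarrow> smooth w"
  by (simp add: solutions_def)

text \<open>Stacking the rows of two kernel representations describes the intersection; with sets of
  rows this is a union.\<close>

lemma linear_behaviors_Int:
  assumes "B1 \<in> linear_behaviors" "B2 \<in> linear_behaviors"
  shows "\<exists>S. B1 \<inter> B2 = solutions S"
proof -
  obtain p1 R1 p2 R2 where "B1 = kernel_behavior p1 R1" "B2 = kernel_behavior p2 R2"
    using assms by (auto simp: linear_behaviors_def)
  then have "B1 \<inter> B2 = solutions (R1 ` {..<p1} \<union> R2 ` {..<p2})"
    by (auto simp: kernel_behavior_def solutions_def row_op_def)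
  then show ?thesis by blast
qed

lemma row_op_lincomb:
  assumes "smooth u" "smooth v"
  shows "row_op r (\<lambda>t. a *\<^sub>R u t + b *\<^sub>R v t) t = a * row_op r u t + b * row_op r v t"
  using iterated_ddt_lincomb[OF smooth_component smooth_component, OF assms, where a = a and b = b]
  by (simp add: row_op_def poly_ddt_def sum.distrib sum_distrib_left algebra_simps)

lemma solutions_lincomb:
  assumes "u \<in> solutions S" "v \<in> solutions S"
  shows "(\<lambda>t. a *\<^sub>R u t + b *\<^sub>R v t) \<in> solutions S"
  using assms by (auto simp: solutions_def row_op_lincomb intro: smooth_lincomb)

lemma solutions_shift:
  assumes "w \<in> solutions S"
  shows "(\<lambda>t. w (t + h)) \<in> solutions S"
proof -
  have w: "smooth w" using assms by (rule solutions_smooth)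
  have "row_op r (\<lambda>t. w (t + h)) t = row_op r w (t + h)" for r t
    using iterated_ddt_shift[OF smooth_component[OF w], where h = h]
    by (simp add: row_op_def poly_ddt_def)
  then show ?thesis
    using assms w by (auto simp: solutions_def intro: smooth_shift)
qed

section \<open>The module of annihilating rows and elimination in it\<close>

lemma annihilators_0: "0 \<in> annihilators B"
  by (simp add: annihilators_def row_op_def)

lemma annihilators_add:
  "r \<in> annihilators B \<Longrightarrow> s \<in> annihilators B \<Longrightarrow> r + s \<in> annihilators B"
  by (simp add: annihilators_def row_op_def poly_ddt_add sum.distrib)

lemma annihilators_mult_const: "r \<in> annihilators B \<Longrightarrow> [:a:] *s r \<in> annihilators B"
  by (simp add: annihilators_def row_op_def poly_ddt_smult flip: sum_distrib_left)

text \<open>Induction along Horner's scheme: multiplying a row by the indeterminate differentiates a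
  function that is identically zero along \<open>B\<close>.\<close>

lemma annihilators_mult:
  assumes "r \<in> annihilators B" and "\<And>w. w \<in> B \<Longrightarrow> smooth w"
  shows "p *s r \<in> annihilators B"
proof (induction p)
  case 0
  then show ?case by (simp add: annihilators_0)
next
  case (pCons a p)
  have "(\<chi> j. pCons 0 ((p *s r) $ j)) \<in> annihilators B"
    unfolding annihilators_def
  proof safe
    fix w t assume w: "w \<in> B"
    have "row_op (p *s r) w = (\<lambda>t. 0)"
      using pCons.IH w by (auto simp: annihilators_def)
    moreover have "(row_op (p *s r) w has_real_derivative row_op (\<chi> j. pCons 0 ((p *s r) $ j)) w t) (at t)"
      unfolding row_op_def
      using poly_ddt_has_derivative[OF smooth_component[OF assms(2)[OF w]]]
      by (auto intro!: DERIV_sum simp del: vector_smult_component)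
    ultimately show "row_op (\<chi> j. pCons 0 ((p *s r) $ j)) w t = 0"
      by (metis DERIV_const DERIV_unique)
  qed
  moreover have "pCons a p *s r = [:a:] *s r + (\<chi> j. pCons 0 ((p *s r) $ j))"
    by (simp add: vec_eq_iff)
  ultimately show ?case
    using annihilators_add annihilators_mult_const[OF assms(1)] by metis
qed

lemma annihilators_sum:
  "(\<And>i. i \<in> I \<Longrightarrow> f i \<in> annihilators B) \<Longrightarrow> sum f I \<in> annihilators B"
  by (induction I rule: infinite_finite_induct) (auto simp: annihilators_0 annihilators_add)

text \<open>Gaussian elimination without division; evaluation at 1 keeps the pivots nonzero.\<close>

lemma annihilators_elimination:
  fixes B :: "(real \<Rightarrow> real ^ 'q::finite) set"
  assumes smooth: "\<And>w. w \<in> B \<Longrightarrow> smooth w"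
    and "finite J"
    and "\<And>j. j \<in> J \<Longrightarrow> r j \<in> annihilators B"
    and "\<And>i j. j \<in> J \<Longrightarrow> i \<notin> J \<Longrightarrow> r j $ i = 0"
    and "\<And>i j. j \<in> J \<Longrightarrow> i \<in> J \<Longrightarrow> poly (r j $ i) 1 = (if i = j then 1 else 0)"
  shows "\<forall>j\<in>J. \<exists>p. poly p 1 \<noteq> 0 \<and> p *s axis j 1 \<in> annihilators B"
  using assms(2-)
proof (induction J arbitrary: r rule: finite_induct)
  case empty
  then show ?case by simp
next
  case (insert k J)
  \<comment> \<open>Cross-multiplication clears column \<open>k\<close>. At 1 the factor
    \<open>r k $ k\<close> is 1 and \<open>r j $ k\<close> is 0, so \<open>r' j\<close> has the same
    values at 1 as \<open>r j\<close>, and the identity pattern survives.\<close>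
  define r' where "r' j = (r k $ k) *s r j + (- (r j $ k)) *s r k" for j
  note mult = annihilators_mult[OF _ smooth]
  have "\<forall>j\<in>J. \<exists>p. poly p 1 \<noteq> 0 \<and> p *s axis j 1 \<in> annihilators B"
  proof (rule insert.IH)
    show "r' j \<in> annihilators B" if "j \<in> J" for j
      unfolding r'_def using that insert.prems(1) by (intro annihilators_add mult) auto
    show "r' j $ i = 0" if "j \<in> J" "i \<notin> J" for i j
      using that insert.prems(2)[of j i] insert.prems(2)[of k i]
      by (cases "i = k") (auto simp: r'_def)
    show "poly (r' j $ i) 1 = (if i = j then 1 else 0)" if "j \<in> J" "i \<in> J" for i j
      using that insert.hyps insert.prems(3)[of j i] insert.prems(3)[of k i]
        insert.prems(3)[of k k] insert.prems(3)[of j k]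
      by (auto simp: r'_def)
  qed
  then obtain p where p: "\<And>j. j \<in> J \<Longrightarrow> poly (p j) 1 \<noteq> 0"
    "\<And>j. j \<in> J \<Longrightarrow> p j *s axis j 1 \<in> annihilators B"
    by metis
  \<comment> \<open>A common multiple of all \<open>p j\<close>, so that every polynomial multiple
    of \<open>P *s axis j 1\<close> with \<open>j\<close> in \<open>J\<close> annihilates
    \<open>B\<close>.\<close>
  define P where "P = prod p J"
  have P1: "poly P 1 \<noteq> 0"
    using p(1) insert.hyps by (simp add: P_def poly_prod)
  have Pj: "(q * P) *s axis j 1 \<in> annihilators B" if "j \<in> J" for q j
  proof -
    have "P = p j * prod p (J - {j})"
      using that insert.hyps by (simp add: P_def prod.remove)
    then have "(q * P) *s axis j 1 = (q * prod p (J - {j})) *s (p j *s axis j 1)"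
      by (simp add: vec_eq_iff algebra_simps)
    then show ?thesis using mult[OF p(2)[OF that]] by simp
  qed
  \<comment> \<open>Back substitution: scaling row \<open>k\<close> by \<open>P\<close> allows its
    entries in the columns of \<open>J\<close> to be cancelled, which leaves only the pivot.\<close>
  have "(P * r k $ k) *s axis k 1 = P *s r k + (\<Sum>j\<in>J. (- (r k $ j) * P) *s axis j 1)"
  proof (rule vec_eq_iff[THEN iffD2], rule allI)
    fix i
    have "(\<Sum>j\<in>J. ((- (r k $ j) * P) *s axis j 1) $ i)
        = (\<Sum>j\<in>J. if i = j then - (r k $ j) * P else 0)"
      by (intro sum.cong) (auto simp: axis_def)
    also have "\<dots> = (if i \<in> J then - (r k $ i) * P else 0)"
      using insert.hyps(1) by simp
    finally show "((P * r k $ k) *s axis k 1) $ i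
        = (P *s r k + (\<Sum>j\<in>J. (- (r k $ j) * P) *s axis j 1)) $ i"
      using insert.hyps(2) insert.prems(2)[of k i] by (auto simp: axis_def)
  qed
  also have "\<dots> \<in> annihilators B"
    by (intro annihilators_add annihilators_sum Pj mult insert.prems(1)) auto
  finally have "(P * r k $ k) *s axis k 1 \<in> annihilators B" .
  moreover have "poly (P * r k $ k) 1 \<noteq> 0"
    using P1 insert.prems(3)[of k k] by simp
  ultimately show ?case using p by blast
qed

text \<open>The values at 1 of the annihilating rows form a real subspace. A nonzero vector
  orthogonal to it would be the direction of an exponential solution, so the subspace is everything.
  Rows whose values at 1 are the unit vectors are the input for the elimination.\<close>

lemma scalar_equations_if_no_exp:
  fixes S :: "(real poly ^ 'q::finite) set"
  assumes "\<And>x. (\<lambda>t. exp t *\<^sub>R x) \<in> solutions S \<Longrightarrow> x = 0"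
  shows "\<exists>p. p \<noteq> 0 \<and> (\<forall>w\<in>solutions S. \<forall>t. poly_ddt p (\<lambda>s. w s $ j) t = 0)"
proof -
  let ?A = "annihilators (solutions S)"
  define ev where "ev r = (\<chi> i. poly (r $ i) 1)" for r :: "real poly ^ 'q"
  have sub: "subspace (ev ` ?A)"
  proof (rule subspaceI)
    show "0 \<in> ev ` ?A"
      by (rule image_eqI[OF _ annihilators_0]) (simp add: ev_def vec_eq_iff)
    show "x + y \<in> ev ` ?A" if xy: "x \<in> ev ` ?A" "y \<in> ev ` ?A" for x y
    proof -
      from xy obtain r s where "r \<in> ?A" "s \<in> ?A" "x = ev r" "y = ev s" by blast
      then show ?thesis
        by (intro image_eqI[of _ _ "r + s"]) (auto simp: annihilators_add ev_def vec_eq_iff)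
    qed
    show "c *\<^sub>R x \<in> ev ` ?A" if x: "x \<in> ev ` ?A" for c x
    proof -
      from x obtain r where "r \<in> ?A" "x = ev r" by blast
      then show ?thesis
        by (intro image_eqI[of _ _ "[:c:] *s r"])
          (auto simp: annihilators_mult_const ev_def vec_eq_iff)
    qed
  qed
  have "ev ` ?A = UNIV"
  proof (rule ccontr)
    assume "ev ` ?A \<noteq> UNIV"
    have "span (ev ` ?A) = ev ` ?A"
      using sub by (simp only: span_eq_iff)
    then obtain x where x: "x \<noteq> 0" "\<And>y. y \<in> ev ` ?A \<Longrightarrow> x \<bullet> y = 0"
      using span_not_UNIV_orthogonal[of "ev ` ?A"] \<open>ev ` ?A \<noteq> UNIV\<close> by metis
    have "(\<lambda>t. exp t *\<^sub>R x) \<in> solutions S"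
      unfolding solutions_def
    proof (safe intro!: smooth_exp)
      fix r t assume "r \<in> S"
      then have "r \<in> ?A" by (auto simp: annihilators_def solutions_def)
      then have "x \<bullet> ev r = 0" using x by blast
      have "row_op r (\<lambda>t. exp t *\<^sub>R x) t = exp t * (x \<bullet> ev r)"
        by (simp add: row_op_def poly_ddt_exp ev_def inner_vec_def sum_distrib_left algebra_simps)
      with \<open>x \<bullet> ev r = 0\<close> show "row_op r (\<lambda>t. exp t *\<^sub>R x) t = 0" by simp
    qed
    with assms x show False by blast
  qed
  then have "\<forall>j. \<exists>r\<in>?A. ev r = axis j 1"
    by (metis UNIV_I imageE)
  then obtain r where r: "\<And>j. r j \<in> ?A" "\<And>j. ev (r j) = axis j 1"
    by metis
  have "poly (r j $ i) 1 = (if i = j then 1 else 0)" for i j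
    using arg_cong[OF r(2)[of j], of "\<lambda>x. x $ i"] by (simp add: ev_def axis_def)
  then have "\<forall>j\<in>UNIV. \<exists>p. poly p 1 \<noteq> 0 \<and> p *s axis j 1 \<in> ?A"
    by (intro annihilators_elimination[of _ _ r]) (auto simp: r solutions_smooth)
  then obtain p where p: "poly p 1 \<noteq> 0" "p *s axis j 1 \<in> ?A" by blast
  have "row_op (p *s axis j 1) w t = poly_ddt p (\<lambda>s. w s $ j) t" for w t
  proof -
    have "row_op (p *s axis j 1) w t
        = (\<Sum>i\<in>UNIV. if i = j then poly_ddt p (\<lambda>s. w s $ j) t else 0)"
      unfolding row_op_def by (intro sum.cong) (auto simp: axis_def)
    then show ?thesis by simp
  qed
  then show ?thesis
    using p by (intro exI[of _ p]) (auto simp: annihilators_def)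
qed

section \<open>Functions of exponential type\<close>

text \<open>The bounds on the derivatives make the Taylor series converge everywhere.\<close>

definition exp_type_derivs :: "(nat \<Rightarrow> real \<Rightarrow> real) \<Rightarrow> bool" where
  "exp_type_derivs F \<longleftrightarrow> (\<forall>m t. (F m has_real_derivative F (Suc m) t) (at t)) \<and>
     (\<forall>T. \<exists>C\<ge>0. \<exists>M\<ge>0. \<forall>m t. \<bar>t\<bar> \<le> T \<longrightarrow> \<bar>F m t\<bar> \<le> C * M ^ m)"

definition exp_type :: "(real \<Rightarrow> real) \<Rightarrow> bool" where
  "exp_type f \<longleftrightarrow> (\<exists>F. exp_type_derivs F \<and> F 0 = f)"

text \<open>The Taylor polynomials at \<open>a\<close> vanish, so the value equals the Lagrange
  remainder of every order, which is at most \<open>C * (M * |x|)^n / n!\<close> and tends to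
  0.\<close>

lemma exp_type_derivs_eq_0:
  assumes F: "exp_type_derivs F" and a: "\<And>m. F m a = 0"
  shows "F 0 t = 0"
proof -
  define x where "x = t - a"
  \<comment> \<open>The radius covers every intermediate point \<open>s + a\<close> with
    \<open>s\<close> no larger than \<open>x\<close> in absolute value.\<close>
  obtain C M where CM: "C \<ge> 0" "M \<ge> 0"
    "\<And>m s. \<bar>s\<bar> \<le> \<bar>x\<bar> + \<bar>a\<bar> \<Longrightarrow> \<bar>F m s\<bar> \<le> C * M ^ m"
    using F unfolding exp_type_derivs_def by meson
  have deriv: "((\<lambda>s. F m (s + a)) has_real_derivative F (Suc m) (s + a)) (at s)" for m s
    using F unfolding exp_type_derivs_def by (subst DERIV_shift[symmetric]) blast
  have bound: "\<bar>F 0 (x + a)\<bar> \<le> C * ((M * \<bar>x\<bar>) ^ n / fact n)" for n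
  proof -
    obtain s where s: "\<bar>s\<bar> \<le> \<bar>x\<bar>"
      "F 0 (x + a) = (\<Sum>m<n. F m (0 + a) / fact m * x ^ m) + F n (s + a) / fact n * x ^ n"
      using Maclaurin_all_le_objl[of "\<lambda>m s. F m (s + a)" "\<lambda>s. F 0 (s + a)" x n] deriv by blast
    have "\<bar>F 0 (x + a)\<bar> = \<bar>F n (s + a)\<bar> * (\<bar>x\<bar> ^ n / fact n)"
      using s(2) a by (simp add: abs_mult power_abs)
    also have "\<dots> \<le> (C * M ^ n) * (\<bar>x\<bar> ^ n / fact n)"
      using s(1) by (intro mult_right_mono CM(3)) auto
    finally show ?thesis by (simp add: power_mult_distrib)
  qed
  have "(\<lambda>n. C * ((M * \<bar>x\<bar>) ^ n / fact n)) \<longlonglongrightarrow> C * 0"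
    using summable_LIMSEQ_zero[OF summable_exp[of "M * \<bar>x\<bar>"]]
    by (intro tendsto_mult_left) (simp add: field_simps)
  then have "\<bar>F 0 (x + a)\<bar> \<le> C * 0"
    using bound by (intro LIMSEQ_le_const) auto
  then show ?thesis by (simp add: x_def)
qed

text \<open>Identity theorem: \<open>f - c\<close> vanishes with all its derivatives at the midpoint
  of the interval.\<close>

lemma exp_type_identity:
  assumes f: "exp_type f" and ab: "a < b" and c: "\<And>t. a < t \<Longrightarrow> t < b \<Longrightarrow> f t = c"
  shows "f t = c"
proof -
  obtain F where F: "exp_type_derivs F" "F 0 = f"
    using f by (auto simp: exp_type_def)
  \<comment> \<open>The derivatives of \<open>f - c\<close>. Only order 0 changes, where
    \<open>M ^ 0 = 1\<close>, so adding the absolute value of \<open>c\<close> to \<open>C\<close>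
    keeps the growth bound.\<close>
  define G where "G m s = F m s - (if m = 0 then c else 0)" for m s
  have GD: "(G m has_real_derivative G (Suc m) s) (at s)" for m s
    using F(1) unfolding G_def exp_type_derivs_def
    by (auto intro!: derivative_eq_intros)
  have "exp_type_derivs G"
    unfolding exp_type_derivs_def
  proof (intro conjI allI GD)
    fix T
    obtain C M where CM: "C \<ge> 0" "M \<ge> 0" "\<And>m s. \<bar>s\<bar> \<le> T \<Longrightarrow> \<bar>F m s\<bar> \<le> C * M ^ m"
      using F(1) unfolding exp_type_derivs_def by meson
    have "\<bar>G m s\<bar> \<le> (C + \<bar>c\<bar>) * M ^ m" if "\<bar>s\<bar> \<le> T" for m s
      using CM(3)[OF that, of m] CM(1,2) by (cases m) (auto simp: G_def algebra_simps add_increasing2)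
    then show "\<exists>C\<ge>0. \<exists>M\<ge>0. \<forall>m t. \<bar>t\<bar> \<le> T \<longrightarrow> \<bar>G m t\<bar> \<le> C * M ^ m"
      using CM(1,2) by (intro exI[of _ "C + \<bar>c\<bar>"] conjI exI[of _ M]) auto
  qed
  moreover have "G m s = 0" if "a < s" "s < b" for m s
    using that
  proof (induction m arbitrary: s)
    case 0
    then show ?case using c F(2) by (simp add: G_def)
  next
    case (Suc m)
    have "(G m has_real_derivative 0) (at s)"
      by (rule has_field_derivative_transform_within_open[where f = "\<lambda>s. 0" and S = "{a<..<b}"])
        (use Suc in auto)
    then show ?case using DERIV_unique[OF GD] by blast
  qed
  then have "G m ((a + b) / 2) = 0" for m using ab by simp
  ultimately have "G 0 t = 0" by (rule exp_type_derivs_eq_0)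
  then show ?thesis using F(2) by (simp add: G_def)
qed

section \<open>Closure of exponential type under sums and products\<close>

lemma exp_type_const: "exp_type (\<lambda>t. c)"
proof -
  let ?F = "\<lambda>m t. if m = 0 then c else 0 :: real"
  have "\<exists>C\<ge>0. \<exists>M\<ge>0. \<forall>m t. \<bar>t\<bar> \<le> T \<longrightarrow> \<bar>?F m t\<bar> \<le> C * M ^ m" for T
    by (intro exI[of _ "\<bar>c\<bar>"] exI[of _ 1] conjI) auto
  moreover have "(?F m has_real_derivative ?F (Suc m) t) (at t)" for m t
    by auto
  ultimately have "exp_type_derivs ?F"
    unfolding exp_type_derivs_def by blast
  then show ?thesis unfolding exp_type_def by (intro exI[of _ ?F]) auto
qed

lemma exp_type_add:
  assumes "exp_type f" "exp_type g"
  shows "exp_type (\<lambda>t. f t + g t)"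
proof -
  obtain F G where F: "exp_type_derivs F" "F 0 = f" and G: "exp_type_derivs G" "G 0 = g"
    using assms by (auto simp: exp_type_def)
  have "exp_type_derivs (\<lambda>m t. F m t + G m t)"
    unfolding exp_type_derivs_def
  proof (intro conjI allI)
    show "((\<lambda>t. F m t + G m t) has_real_derivative F (Suc m) t + G (Suc m) t) (at t)" for m t
      using F(1) G(1) by (intro DERIV_add) (auto simp: exp_type_derivs_def)
    fix T
    obtain C M where CM: "C \<ge> 0" "M \<ge> 0" "\<And>m s. \<bar>s\<bar> \<le> T \<Longrightarrow> \<bar>F m s\<bar> \<le> C * M ^ m"
      using F(1) unfolding exp_type_derivs_def by meson
    obtain C' M' where CM': "C' \<ge> 0" "M' \<ge> 0" "\<And>m s. \<bar>s\<bar> \<le> T \<Longrightarrow> \<bar>G m s\<bar> \<le> C' * M' ^ m"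
      using G(1) unfolding exp_type_derivs_def by meson
    have "\<bar>F m t + G m t\<bar> \<le> (C + C') * (max M M') ^ m" if t: "\<bar>t\<bar> \<le> T" for m t
    proof -
      have "C * M ^ m \<le> C * (max M M') ^ m" "C' * M' ^ m \<le> C' * (max M M') ^ m"
        using CM(1,2) CM'(1,2) by (auto intro!: mult_left_mono power_mono)
      then show ?thesis
        using CM(3)[OF t, of m] CM'(3)[OF t, of m] by (simp add: distrib_right)
    qed
    then show "\<exists>C\<ge>0. \<exists>M\<ge>0. \<forall>m t. \<bar>t\<bar> \<le> T \<longrightarrow> \<bar>F m t + G m t\<bar> \<le> C * M ^ m"
      using CM(1,2) CM'(1,2) by (intro exI[of _ "C + C'"] exI[of _ "max M M'"] conjI) auto
  qed
  then show ?thesis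
    unfolding exp_type_def using F(2) G(2) by (intro exI[of _ "\<lambda>m t. F m t + G m t"] conjI) auto
qed

text \<open>The derivative of order \<open>m\<close> of \<open>F k * G l\<close>, expanded by
  repeated use of the product rule instead of binomial coefficients. The free indices
  \<open>k\<close> and \<open>l\<close> make induction on \<open>m\<close> possible.\<close>

fun leibniz :: "(nat \<Rightarrow> real \<Rightarrow> real) \<Rightarrow> (nat \<Rightarrow> real \<Rightarrow> real) \<Rightarrow> nat \<Rightarrow> nat \<Rightarrow> nat \<Rightarrow> real \<Rightarrow> real" where
  "leibniz F G 0 k l t = F k t * G l t"
| "leibniz F G (Suc m) k l t = leibniz F G m (Suc k) l t + leibniz F G m k (Suc l) t"

lemma exp_type_mult:
  assumes "exp_type f" "exp_type g"
  shows "exp_type (\<lambda>t. f t * g t)"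
proof -
  obtain F G where F: "exp_type_derivs F" "F 0 = f" and G: "exp_type_derivs G" "G 0 = g"
    using assms by (auto simp: exp_type_def)
  have D: "(leibniz F G m k l has_real_derivative leibniz F G (Suc m) k l t) (at t)" for m k l t
  proof (induction m arbitrary: k l)
    case 0
    have "(F k has_real_derivative F (Suc k) t) (at t)" "(G l has_real_derivative G (Suc l) t) (at t)"
      using F(1) G(1) by (auto simp: exp_type_derivs_def)
    from DERIV_mult'[OF this] show ?case by (simp add: algebra_simps)
  next
    case (Suc m)
    from DERIV_add[OF Suc.IH[of "Suc k" l] Suc.IH[of k "Suc l"]] show ?case
      by simp
  qed
  have "exp_type_derivs (\<lambda>m. leibniz F G m 0 0)"
    unfolding exp_type_derivs_def
  proof (intro conjI allI D)
    fix T
    obtain C M where CM: "C \<ge> 0" "M \<ge> 0" "\<And>m s. \<bar>s\<bar> \<le> T \<Longrightarrow> \<bar>F m s\<bar> \<le> C * M ^ m"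
      using F(1) unfolding exp_type_derivs_def by meson
    obtain C' M' where CM': "C' \<ge> 0" "M' \<ge> 0" "\<And>m s. \<bar>s\<bar> \<le> T \<Longrightarrow> \<bar>G m s\<bar> \<le> C' * M' ^ m"
      using G(1) unfolding exp_type_derivs_def by meson
    \<comment> \<open>Each differentiation raises either \<open>k\<close> or \<open>l\<close> by
      one, contributing a factor \<open>M\<close> or \<open>M'\<close>; summed, every order
      contributes \<open>M + M'\<close>.\<close>
    have b: "\<bar>leibniz F G m k l t\<bar> \<le> (C * M ^ k) * (C' * M' ^ l) * (M + M') ^ m"
      if t: "\<bar>t\<bar> \<le> T" for m k l t
    proof (induction m arbitrary: k l)
      case 0
      show ?case
        using mult_mono'[OF CM(3)[OF t, of k] CM'(3)[OF t, of l]] by (simp add: abs_mult)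
    next
      case (Suc m)
      show ?case
        using Suc.IH[of "Suc k" l] Suc.IH[of k "Suc l"] by (simp add: algebra_simps)
    qed
    show "\<exists>C\<ge>0. \<exists>M\<ge>0. \<forall>m t. \<bar>t\<bar> \<le> T \<longrightarrow> \<bar>leibniz F G m 0 0 t\<bar> \<le> C * M ^ m"
      using CM(1,2) CM'(1,2) b[of _ _ 0 0]
      by (intro exI[of _ "C * C'"] exI[of _ "M + M'"] conjI) auto
  qed
  then show ?thesis
    unfolding exp_type_def using F(2) G(2)
    by (intro exI[of _ "\<lambda>m. leibniz F G m 0 0"] conjI) auto
qed

lemma exp_type_sum:
  "(\<And>i. i \<in> I \<Longrightarrow> exp_type (f i)) \<Longrightarrow> exp_type (\<lambda>t. \<Sum>i\<in>I. f i t)"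
  by (induction I rule: infinite_finite_induct) (auto intro: exp_type_const exp_type_add)

section \<open>Scalar linear equations with constant coefficients\<close>

lemma poly_ddt_recurrence:
  assumes f: "smooth f" and p: "p \<noteq> 0" and eq: "\<And>t. poly_ddt p f t = 0"
  shows "(ddt ^^ (degree p + m)) f t
    = (\<Sum>k<degree p. - (coeff p k / lead_coeff p) * (ddt ^^ (k + m)) f t)"
proof -
  let ?s = "\<lambda>m t. \<Sum>k\<le>degree p. coeff p k * (ddt ^^ (k + m)) f t"
  \<comment> \<open>The equation differentiated \<open>m\<close> times; its top term is then
    isolated by dividing by the leading coefficient.\<close>
  have "?s m t = 0" for t
  proof (induction m arbitrary: t)
    case 0
    then show ?case using eq by (simp add: poly_ddt_def)
  next
    case (Suc m)
    have deriv: "(?s m has_real_derivative ?s (Suc m) t) (at t)"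
      using smooth_has_real_derivative[OF f]
      by (auto intro!: derivative_eq_intros sum.cong simp del: funpow.simps)
    have "?s m = (\<lambda>t. 0)" using Suc by auto
    with deriv have "((\<lambda>t. 0) has_real_derivative ?s (Suc m) t) (at t)" by (simp only:)
    then show ?case by (rule DERIV_unique[OF _ DERIV_const])
  qed
  then have "lead_coeff p * (ddt ^^ (degree p + m)) f t
      + (\<Sum>k<degree p. coeff p k * (ddt ^^ (k + m)) f t) = 0"
    by (simp add: lessThan_Suc_atMost[symmetric] add.commute)
  then have "(ddt ^^ (degree p + m)) f t
      = - (\<Sum>k<degree p. coeff p k * (ddt ^^ (k + m)) f t) / lead_coeff p"
    using p by (simp add: field_simps add_eq_0_iff)
  then show ?thesis
    by (simp add: sum_negf sum_divide_distrib)
qed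

text \<open>On a compact interval the first \<open>n\<close> derivatives are bounded by continuity,
  and the recurrence bounds each later one by \<open>K\<close> times a bound for the
  \<open>n\<close> before it.\<close>

lemma exp_type_derivs_if_poly_ddt:
  assumes f: "smooth f" and p: "p \<noteq> 0" and eq: "\<And>t. poly_ddt p f t = 0"
  shows "exp_type_derivs (\<lambda>m. (ddt ^^ m) f)"
  unfolding exp_type_derivs_def
proof (intro conjI allI smooth_has_real_derivative f)
  fix T
  define n where "n = degree p"
  define K where "K = (\<Sum>k<n. \<bar>coeff p k / lead_coeff p\<bar>)"
  \<comment> \<open>With \<open>M\<close> at least 1 the powers of \<open>M\<close> increase, so
    \<open>C\<close> itself serves for orders below \<open>n\<close> and \<open>M ^ (m - 1)\<close>
    dominates all terms of the recurrence.\<close>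
  define M where "M = max 1 K"
  have "\<exists>C\<ge>0. \<forall>t. \<bar>t\<bar> \<le> T \<longrightarrow> \<bar>(ddt ^^ k) f t\<bar> \<le> C" for k
  proof -
    have "continuous_on (cball 0 T) ((ddt ^^ k) f)"
      using smooth_has_real_derivative[OF f]
      by (intro continuous_at_imp_continuous_on) (auto intro: DERIV_isCont)
    then have "bounded ((ddt ^^ k) f ` (cball 0 T))"
      by (intro compact_imp_bounded compact_continuous_image) auto
    then obtain C where "\<forall>t\<in>cball 0 T. \<bar>(ddt ^^ k) f t\<bar> \<le> C"
      by (auto simp: bounded_iff)
    then show ?thesis
      by (intro exI[of _ "max 0 C"]) (auto simp: le_max_iff_disj)
  qed
  then obtain c where c: "\<And>k. c k \<ge> 0" "\<And>k t. \<bar>t\<bar> \<le> T \<Longrightarrow> \<bar>(ddt ^^ k) f t\<bar> \<le> c k"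
    by metis
  define C where "C = (\<Sum>k<n. c k)"
  have C0: "C \<ge> 0" by (simp add: C_def sum_nonneg c)
  have M: "M \<ge> 1" "K \<le> M" by (auto simp: M_def)
  have "\<bar>(ddt ^^ m) f t\<bar> \<le> C * M ^ m" if t: "\<bar>t\<bar> \<le> T" for m t
  proof (induction m rule: less_induct)
    case (less m)
    show ?case
    proof (cases "m < n")
      case True
      have "\<bar>(ddt ^^ m) f t\<bar> \<le> C * 1"
        using c(2)[OF t, of m] member_le_sum[of m "{..<n}" c] True c(1) by (simp add: C_def)
      also have "\<dots> \<le> C * M ^ m"
        using C0 M by (intro mult_left_mono) auto
      finally show ?thesis .
    next
      case False
      then obtain l where m: "m = n + l" using le_Suc_ex not_less by blast
      have "\<bar>(ddt ^^ m) f t\<bar> \<le> (\<Sum>k<n. \<bar>coeff p k / lead_coeff p\<bar> * \<bar>(ddt ^^ (k + l)) f t\<bar>)"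
        unfolding m n_def poly_ddt_recurrence[OF assms]
        by (rule order_trans[OF sum_abs]) (simp add: abs_mult)
      also have "\<dots> \<le> (\<Sum>k<n. \<bar>coeff p k / lead_coeff p\<bar> * (C * M ^ (m - 1)))"
      proof (intro sum_mono mult_left_mono)
        fix k assume k: "k \<in> {..<n}"
        then have "\<bar>(ddt ^^ (k + l)) f t\<bar> \<le> C * M ^ (k + l)"
          by (intro less) (simp add: m)
        also have "\<dots> \<le> C * M ^ (m - 1)"
          using k C0 M by (intro mult_left_mono power_increasing) (auto simp: m)
        finally show "\<bar>(ddt ^^ (k + l)) f t\<bar> \<le> C * M ^ (m - 1)" .
      qed auto
      also have "\<dots> = K * (C * M ^ (m - 1))"
        by (simp add: K_def sum_distrib_right)
      also have "\<dots> \<le> C * M ^ m"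
      \<comment> \<open>If \<open>m = 0\<close>, where \<open>m - 1\<close> is truncated, then
        \<open>n = 0\<close> and \<open>K\<close> is an empty sum.\<close>
      proof (cases m)
        case 0
        then show ?thesis using m C0 by (simp add: K_def)
      next
        case (Suc m')
        have "K * (C * M ^ m') \<le> M * (C * M ^ m')"
          using M C0 by (intro mult_right_mono) auto
        then show ?thesis using Suc by (simp add: algebra_simps)
      qed
      finally show ?thesis .
    qed
  qed
  then show "\<exists>C\<ge>0. \<exists>M\<ge>0. \<forall>m t. \<bar>t\<bar> \<le> T \<longrightarrow> \<bar>(ddt ^^ m) f t\<bar> \<le> C * M ^ m"
    using C0 M by (intro exI[of _ C] exI[of _ M] conjI) auto
qed

text \<open>The recurrence propagates zero initial data to all derivatives at \<open>a\<close>, and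
  a function of exponential type that is flat at a point vanishes.\<close>

lemma poly_ddt_initial_value_unique:
  assumes f: "smooth f" and p: "p \<noteq> 0" and eq: "\<And>t. poly_ddt p f t = 0"
    and init: "\<And>k. k < degree p \<Longrightarrow> (ddt ^^ k) f a = 0"
  shows "f t = 0"
proof -
  have "(ddt ^^ m) f a = 0" for m
  proof (induction m rule: less_induct)
    case (less m)
    show ?case
    proof (cases "m < degree p")
      case False
      then obtain l where m: "m = degree p + l" using le_Suc_ex not_less by blast
      show ?thesis
        unfolding m poly_ddt_recurrence[OF f p eq]
        by (intro sum.neutral ballI) (use less in \<open>auto simp: m\<close>)
    qed (use init in auto)
  qed
  from exp_type_derivs_eq_0[OF exp_type_derivs_if_poly_ddt[OF f p eq] this]
  show ?thesis by simp
qed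

section \<open>Representation of functionals by a definite form\<close>

text \<open>Linear structure is expressed pointwise on a set of functions; one condition with two
  scalars covers both sums and multiples.\<close>

definition fun_subspace :: "('b \<Rightarrow> 'a::real_vector) set \<Rightarrow> bool" where
  "fun_subspace X \<longleftrightarrow> (\<lambda>t. 0) \<in> X \<and> (\<forall>u\<in>X. \<forall>v\<in>X. \<forall>a b. (\<lambda>t. a *\<^sub>R u t + b *\<^sub>R v t) \<in> X)"

definition functional_on :: "('b \<Rightarrow> 'a::real_vector) set \<Rightarrow> (('b \<Rightarrow> 'a) \<Rightarrow> real) \<Rightarrow> bool" where
  "functional_on X L \<longleftrightarrow>
     (\<forall>u\<in>X. \<forall>v\<in>X. \<forall>a b. L (\<lambda>t. a *\<^sub>R u t + b *\<^sub>R v t) = a * L u + b * L v)"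

definition definite_form_on ::
  "('b \<Rightarrow> 'a::real_vector) set \<Rightarrow> (('b \<Rightarrow> 'a) \<Rightarrow> ('b \<Rightarrow> 'a) \<Rightarrow> real) \<Rightarrow> bool" where
  "definite_form_on X b \<longleftrightarrow> (\<forall>u\<in>X. functional_on X (b u)) \<and> (\<forall>u\<in>X. \<forall>v\<in>X. b u v = b v u) \<and>
     (\<forall>u\<in>X. 0 \<le> b u u) \<and> (\<forall>u\<in>X. b u u = 0 \<longrightarrow> u = (\<lambda>t. 0))"

lemma functional_onD:
  "functional_on X L \<Longrightarrow> u \<in> X \<Longrightarrow> v \<in> X \<Longrightarrow>
    L (\<lambda>t. a *\<^sub>R u t + b *\<^sub>R v t) = a * L u + b * L v"
  by (simp add: functional_on_def)

lemma functional_on_0: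
  assumes "functional_on X L" "fun_subspace X"
  shows "L (\<lambda>t. 0) = 0"
  using assms functional_onD[of X L "\<lambda>t. 0" "\<lambda>t. 0" 0 0] by (simp add: fun_subspace_def)

lemma functional_on_subset: "functional_on X L \<Longrightarrow> Y \<subseteq> X \<Longrightarrow> functional_on Y L"
  by (auto simp: functional_on_def)

text \<open>Riesz representation, with a finite separating family \<open>F\<close> in the role of
  finite dimension. Induction on \<open>F\<close> passes to the kernel of one functional, where the
  remaining ones still separate.\<close>

lemma functional_on_representation:
  assumes "finite F" and "\<forall>L\<in>F. functional_on X L"
    and "\<forall>u\<in>X. (\<forall>L\<in>F. L u = 0) \<longrightarrow> u = (\<lambda>t. 0)"
    and "fun_subspace X" and "definite_form_on X b" and "functional_on X L"
  shows "\<exists>r\<in>X. \<forall>u\<in>X. L u = b r u"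
  using assms
proof (induction F arbitrary: X L rule: finite_induct)
  case empty
  have z: "(\<lambda>t. 0) \<in> X" using empty.prems(3) by (simp add: fun_subspace_def)
  have "L u = b (\<lambda>t. 0) u" if "u \<in> X" for u
  proof -
    have u: "u = (\<lambda>t. 0)" using empty.prems(2) that by blast
    have "functional_on X (b (\<lambda>t. 0))"
      using empty.prems(4) z unfolding definite_form_on_def by blast
    then show ?thesis
      unfolding u by (simp only: functional_on_0[OF _ empty.prems(3)] empty.prems(5))
  qed
  then show ?case using z by blast
next
  case (insert l F)
  note sub = insert.prems(3) and form = insert.prems(4)
  have l: "functional_on X l" using insert.prems(1) by blast
  have bl: "functional_on X (b u)" if "u \<in> X" for u
    using form that by (simp add: definite_form_on_def)
  have sym: "b u v = b v u" if "u \<in> X" "v \<in> X" for u v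
    using form that by (simp add: definite_form_on_def)
  define Y where "Y = {u \<in> X. l u = 0}"
  have YX: "Y \<subseteq> X" by (auto simp: Y_def)
  have subY: "fun_subspace Y"
    using sub functional_on_0[OF l sub] functional_onD[OF l]
    unfolding fun_subspace_def Y_def by simp
  have formY: "definite_form_on Y b"
    using form YX functional_on_subset[OF _ YX] unfolding definite_form_on_def by blast
  have Riesz: "\<exists>r\<in>Y. \<forall>u\<in>Y. L u = b r u" if "functional_on X L" for L
  proof (rule insert.IH[OF _ _ subY formY])
    show "functional_on Y L" "\<forall>L\<in>F. functional_on Y L"
      using functional_on_subset[OF _ YX] that insert.prems(1) by auto
    show "\<forall>u\<in>Y. (\<forall>L\<in>F. L u = 0) \<longrightarrow> u = (\<lambda>t. 0)"
      using insert.prems(2) unfolding Y_def by blast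
  qed
  show ?case
  proof (cases "X \<subseteq> Y")
    case True
    then show ?thesis using Riesz[OF insert.prems(5)] YX by blast
  next
    case False
    then obtain x where x: "x \<in> X" "l x \<noteq> 0" by (auto simp: Y_def)
    obtain r' where r': "r' \<in> Y" "\<And>u. u \<in> Y \<Longrightarrow> b x u = b r' u"
      using Riesz[OF bl[OF x(1)]] by blast
    \<comment> \<open>\<open>r'\<close> is the orthogonal projection of \<open>x\<close> onto
      \<open>Y\<close>, so \<open>y\<close> is orthogonal to \<open>Y\<close>, while
      \<open>l y = l x\<close> is nonzero.\<close>
    define y where "y = (\<lambda>t. 1 *\<^sub>R x t + (-1) *\<^sub>R r' t)"
    have r'X: "r' \<in> X" using r'(1) YX by blast
    have y: "y \<in> X" using sub x r'X unfolding y_def fun_subspace_def by blast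
    have ly: "l y = l x"
      using functional_onD[OF l x(1) r'X, of 1 "-1"] r'(1) by (simp add: y_def Y_def)
    have yY: "b y u = 0" if "u \<in> Y" for u
    proof -
      have uX: "u \<in> X" using that YX by blast
      have "b u y = 1 * b u x + (-1) * b u r'"
        unfolding y_def by (rule functional_onD[OF bl[OF uX] x(1) r'X])
      then show ?thesis
        using sym[OF uX] y x(1) r'X r'(2)[OF that] by simp
    qed
    have byy: "b y y \<noteq> 0"
    proof
      assume "b y y = 0"
      then have "y = (\<lambda>t. 0)" using form y by (simp add: definite_form_on_def)
      then show False using functional_on_0[OF l sub] ly x(2) by simp
    qed
    obtain s where s: "s \<in> Y" "\<And>u. u \<in> Y \<Longrightarrow> L u = b s u"
      using Riesz[OF insert.prems(5)] by blast
    have sX: "s \<in> X" using s(1) YX by blast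
    \<comment> \<open>The representative on \<open>Y\<close> plus the multiple of \<open>y\<close>
      that gives the right value at \<open>y\<close>.\<close>
    define r where "r = (\<lambda>t. 1 *\<^sub>R s t + (L y / b y y) *\<^sub>R y t)"
    have rX: "r \<in> X" using sub sX y unfolding r_def fun_subspace_def by blast
    have br: "b r u = b s u + L y / b y y * b y u" if u: "u \<in> X" for u
    proof -
      have "b u r = 1 * b u s + (L y / b y y) * b u y"
        unfolding r_def by (rule functional_onD[OF bl[OF u] sX y])
      then show ?thesis using sym u rX sX y by simp
    qed
    have "L u = b r u" if u: "u \<in> X" for u
    proof -
      \<comment> \<open>This scalar puts \<open>u - c y\<close> into the kernel \<open>Y\<close>,
        which splits \<open>u\<close> into orthogonal parts.\<close>
      define c where "c = l u / l x"
      define v where "v = (\<lambda>t. 1 *\<^sub>R u t + (- c) *\<^sub>R y t)"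
      have vX: "v \<in> X" using sub u y unfolding v_def fun_subspace_def by blast
      have lin: "K v = K u - c * K y" if "functional_on X K" for K
        using functional_onD[OF that u y, of 1 "- c"] by (simp add: v_def)
      have vY: "v \<in> Y"
        using lin[OF l] vX ly x(2) by (simp add: Y_def c_def)
      have "b s y = 0" using yY[OF s(1)] sym[OF sX y] by simp
      then have "b s u = b s v" using lin[OF bl[OF sX]] by simp
      moreover have "b y u = c * b y y" using lin[OF bl[OF y]] yY[OF vY] by simp
      moreover have "L u = b s v + c * L y"
        using lin[OF insert.prems(5)] s(2)[OF vY] by simp
      ultimately show ?thesis using byy by (simp add: br[OF u])
    qed
    then show ?thesis using rX by blast
  qed
qed

text \<open>The form is evaluated at \<open>b u u\<close> times \<open>r\<close> minus
  \<open>b r u\<close> times \<open>u\<close>, a multiple of the component of \<open>r\<close>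
  orthogonal to \<open>u\<close>. Avoiding division leaves \<open>b u u = 0\<close> as a separate
  case, in which \<open>u\<close> is zero.\<close>

lemma definite_form_on_Cauchy_Schwarz:
  assumes sub: "fun_subspace X" and form: "definite_form_on X b" and r: "r \<in> X" and u: "u \<in> X"
  shows "(b r u)\<^sup>2 \<le> b r r * b u u"
proof -
  have bl: "functional_on X (b v)" if "v \<in> X" for v
    using form that by (simp add: definite_form_on_def)
  have sym: "b v v' = b v' v" if "v \<in> X" "v' \<in> X" for v v'
    using form that by (simp add: definite_form_on_def)
  define z where "z = (\<lambda>t. b u u *\<^sub>R r t + (- b r u) *\<^sub>R u t)"
  have z: "z \<in> X" using sub r u unfolding z_def fun_subspace_def by blast
  have lin: "b v z = b u u * b v r + (- b r u) * b v u" if "v \<in> X" for v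
    unfolding z_def by (rule functional_onD[OF bl[OF that] r u])
  have "b z z = b u u * (b u u * b r r - (b r u)\<^sup>2)"
    using lin[OF z] lin[OF r] lin[OF u] sym[OF z r] sym[OF z u] sym[OF u r]
    by (simp add: algebra_simps power2_eq_square)
  moreover have "b z z \<ge> 0" "b u u \<ge> 0" using form z u by (auto simp: definite_form_on_def)
  moreover have "b r u = 0" if "b u u = 0"
  proof -
    have "u = (\<lambda>t. 0)" using form u that by (simp add: definite_form_on_def)
    then show ?thesis using functional_on_0[OF bl[OF r] sub] by simp
  qed
  ultimately show ?thesis
    by (cases "b u u = 0") (auto simp: zero_le_mult_iff mult.commute)
qed

section \<open>Quadratic differential forms\<close>

text \<open>A common square range and free coefficients let several forms be combined into one; two
  signal arguments allow polarization.\<close>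

definition bilinear_df ::
  "nat \<Rightarrow> (nat \<Rightarrow> nat \<Rightarrow> real ^ 'q ^ 'q) \<Rightarrow> (real \<Rightarrow> real ^ 'q::finite) \<Rightarrow> (real \<Rightarrow> real ^ 'q) \<Rightarrow> real \<Rightarrow> real"
  where "bilinear_df N A u v t = (\<Sum>k<N. \<Sum>l<N. (ddt ^^ k) u t \<bullet> (A k l *v (ddt ^^ l) v t))"

lemma QDF_eq_bilinear_df: "\<exists>N0. \<forall>N\<ge>N0. \<forall>w. QDF \<Phi> w = bilinear_df N (coeff2 \<Phi>) w w"
proof -
  \<comment> \<open>Exceeds the outer degree and, through the terms of the sum, each inner degree;
    the padded coefficients are zero.\<close>
  define N0 where "N0 = Suc (degree \<Phi>) + (\<Sum>k\<le>degree \<Phi>. Suc (degree (coeff \<Phi> k)))"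
  have "QDF \<Phi> w t = bilinear_df N (coeff2 \<Phi>) w w t" if N: "N \<ge> N0" for N w t
  proof -
    let ?g = "\<lambda>k l. (ddt ^^ k) w t \<bullet> (coeff2 \<Phi> k l *v (ddt ^^ l) w t)"
    have inner: "(\<Sum>l\<le>degree (coeff \<Phi> k). ?g k l) = (\<Sum>l<N. ?g k l)" if k: "k \<le> degree \<Phi>" for k
    proof (rule sum.mono_neutral_left)
      have "Suc (degree (coeff \<Phi> k)) \<le> N"
        using member_le_sum[of k "{..degree \<Phi>}" "\<lambda>k. Suc (degree (coeff \<Phi> k))"] N k
        by (simp add: N0_def)
      then show "{..degree (coeff \<Phi> k)} \<subseteq> {..<N}" by auto
    qed (auto simp: coeff2_def coeff_eq_0)
    have "QDF \<Phi> w t = (\<Sum>k\<le>degree \<Phi>. \<Sum>l<N. ?g k l)"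
      unfolding QDF_def by (intro sum.cong inner) auto
    also have "\<dots> = (\<Sum>k<N. \<Sum>l<N. ?g k l)"
      using N by (intro sum.mono_neutral_left) (auto simp: coeff2_def coeff_eq_0 N0_def)
    finally show ?thesis by (simp add: bilinear_df_def)
  qed
  then show ?thesis by blast
qed

lemma QDF_differentiable:
  assumes "smooth w"
  shows "(QDF \<Phi> w has_real_derivative ddt_map (QDF \<Phi>) w t) (at t)"
proof -
  have "(ddt ^^ k) w differentiable (at t)" for k
    using assms by (simp add: smooth_def)
  moreover have "(\<lambda>s. A *v (ddt ^^ k) w s) differentiable (at t)" for k and A :: "real ^ 'a ^ 'a"
    using bounded_linear.has_vector_derivative[OF matrix_vector_mul_bounded_linear
        smooth_has_vector_derivative[OF assms]]
    by (rule differentiableI_vector)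
  ultimately have "QDF \<Phi> w differentiable (at t)"
    unfolding QDF_def by (intro differentiable_sum differentiable_inner) auto
  then show ?thesis
    by (simp add: ddt_map_def ddt_def vector_derivative_works
        has_real_derivative_iff_has_vector_derivative)
qed

lemma bilinear_df_right_linear:
  assumes "smooth u" "smooth v"
  shows "bilinear_df N A w (\<lambda>t. a *\<^sub>R u t + b *\<^sub>R v t) t
    = a * bilinear_df N A w u t + b * bilinear_df N A w v t"
  by (simp add: bilinear_df_def iterated_ddt_lincomb[OF assms] matrix_vector_right_distrib
      matrix_vector_mult_scaleR inner_add_right sum.distrib sum_distrib_left)

lemma bilinear_df_left_linear:
  assumes "smooth u" "smooth v"
  shows "bilinear_df N A (\<lambda>t. a *\<^sub>R u t + b *\<^sub>R v t) w t
    = a * bilinear_df N A u w t + b * bilinear_df N A v w t"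
  by (simp add: bilinear_df_def iterated_ddt_lincomb[OF assms]
      inner_add_left sum.distrib sum_distrib_left)

lemma bilinear_df_shift:
  assumes "smooth u" "smooth v"
  shows "bilinear_df N A (\<lambda>t. u (t + h)) (\<lambda>t. v (t + h)) t = bilinear_df N A u v (t + h)"
  by (simp add: bilinear_df_def iterated_ddt_shift assms)

lemma bilinear_df_exp:
  "bilinear_df N A (\<lambda>t. exp t *\<^sub>R x) (\<lambda>t. exp t *\<^sub>R x) t
    = exp (2 * t) * bilinear_df N A (\<lambda>t. exp t *\<^sub>R x) (\<lambda>t. exp t *\<^sub>R x) 0"
proof -
  have "exp (2 * t) = exp t * exp t" by (simp flip: exp_add)
  then show ?thesis
    by (simp add: bilinear_df_def iterated_ddt_exp matrix_vector_mult_scaleR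
        sum_distrib_left mult.assoc)
qed

text \<open>In coordinates the form is a polynomial expression in derivatives of the
  components.\<close>

lemma exp_type_bilinear_df:
  assumes "smooth u" "smooth v"
    and "\<And>j k. exp_type ((ddt ^^ k) (\<lambda>s. u s $ j))" and "\<And>j k. exp_type ((ddt ^^ k) (\<lambda>s. v s $ j))"
  shows "exp_type (bilinear_df N A u v)"
proof -
  have eq: "bilinear_df N A u v = (\<lambda>t. \<Sum>k<N. \<Sum>l<N. \<Sum>i\<in>UNIV.
      (ddt ^^ k) (\<lambda>s. u s $ i) t * (\<Sum>j\<in>UNIV. A k l $ i $ j * (ddt ^^ l) (\<lambda>s. v s $ j) t))"
    by (simp add: fun_eq_iff bilinear_df_def inner_vec_def matrix_vector_mult_def
        iterated_ddt_component assms(1,2))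
  show ?thesis
    unfolding eq using assms(3,4) by (intro exp_type_sum exp_type_mult exp_type_const) auto
qed

section \<open>Lyapunov functions\<close>

text \<open>The setting shared by both cases. \<open>V_definite\<close> concerns a \<open>V\<close>
  that vanishes at all times; vanishing on an interval is reduced to this by analyticity.\<close>

locale lyapunov =
  fixes S :: "(real poly ^ 'q::finite) set" and N :: nat and A :: "nat \<Rightarrow> nat \<Rightarrow> real ^ 'q ^ 'q"
  assumes V_nonneg: "\<And>w t. w \<in> solutions S \<Longrightarrow> 0 \<le> bilinear_df N A w w t"
    and V_antimono: "\<And>w s t. w \<in> solutions S \<Longrightarrow> s \<le> t \<Longrightarrow> bilinear_df N A w w t \<le> bilinear_df N A w w s"
    and V_definite: "\<And>w. w \<in> solutions S \<Longrightarrow> (\<And>t. bilinear_df N A w w t = 0) \<Longrightarrow> w = (\<lambda>t. 0)"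
begin

abbreviation V where "V w \<equiv> bilinear_df N A w w"

lemma fun_subspace_solutions: "fun_subspace (solutions S)"
proof -
  have "(\<lambda>t. exp t *\<^sub>R 0) \<in> solutions S"
    using smooth_exp[of "0 :: real ^ 'q"] poly_ddt_exp[of _ 0]
    by (auto simp: solutions_def row_op_def)
  then show ?thesis
    using solutions_lincomb[of _ S] by (simp add: fun_subspace_def)
qed

text \<open>For the difference of two trajectories with a common past, \<open>V\<close> is zero in
  the past, and a nonnegative nonincreasing function stays zero from then on.\<close>

lemma autonomous_solutions: "autonomous (solutions S)"
  unfolding autonomous_def
proof safe
  fix w1 w2 assume w: "w1 \<in> solutions S" "w2 \<in> solutions S" and eq: "\<forall>t<0. w1 t = w2 t"
  define w where "w = (\<lambda>t. 1 *\<^sub>R w1 t + (-1) *\<^sub>R w2 t)"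
  have ws: "w \<in> solutions S" unfolding w_def by (rule solutions_lincomb[OF w])
  have "(ddt ^^ k) w t = 0" if "t < 0" for k t
    using that
  proof (induction k arbitrary: t)
    case 0
    then show ?case using eq by (simp add: w_def)
  next
    case (Suc k)
    have "((ddt ^^ k) w has_vector_derivative 0) (at t)"
      by (rule has_vector_derivative_transform_within_open[where f = "\<lambda>s. 0" and S = "{..<0}"])
        (use Suc in auto)
    then show ?case
      using smooth_has_vector_derivative[OF solutions_smooth[OF ws]] vector_derivative_unique_at
      by metis
  qed
  then have neg: "V w t = 0" if "t < 0" for t
    using that by (simp add: bilinear_df_def)
  \<comment> \<open>\<open>min t (-1)\<close> is a negative time not later than
    \<open>t\<close>.\<close>
  have "V w t = 0" for t
    using V_antimono[OF ws, of "min t (-1)" t] neg[of "min t (-1)"] V_nonneg[OF ws, of t] by simp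
  from V_definite[OF ws this] show "w1 = w2"
    by (auto simp: w_def fun_eq_iff)
qed

text \<open>Along \<open>exp t *\<^sub>R x\<close> the form \<open>V\<close> grows like \<open>exp (2 * t)\<close>, so monotonicity forces it to vanish.\<close>

lemma no_exp_solutions:
  assumes "(\<lambda>t. exp t *\<^sub>R x) \<in> solutions S"
  shows "x = 0"
proof -
  let ?w = "\<lambda>t. exp t *\<^sub>R x"
  have "exp 2 * V ?w 0 \<le> V ?w 0"
    using V_antimono[OF assms, of 0 1] bilinear_df_exp[of N A x 1] by simp
  then have "(exp 2 - 1) * V ?w 0 \<le> 0" by (simp add: algebra_simps)
  moreover have "exp 2 - 1 > (0 :: real)" by simp
  ultimately have "V ?w 0 = 0"
    using V_nonneg[OF assms, of 0] by (auto simp: mult_le_0_iff)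
  then have "V ?w t = 0" for t
    using bilinear_df_exp[of N A x t] by simp
  from V_definite[OF assms this] have "?w 0 = 0" by metis
  then show ?thesis by simp
qed

lemma scalar_equations:
  "\<exists>p. p \<noteq> 0 \<and> (\<forall>w\<in>solutions S. \<forall>t. poly_ddt p (\<lambda>s. w s $ j) t = 0)"
  by (rule scalar_equations_if_no_exp[OF no_exp_solutions])

lemma exp_type_V:
  assumes "w \<in> solutions S"
  shows "exp_type (V w)"
proof -
  have w: "smooth w" using assms by (rule solutions_smooth)
  have "exp_type ((ddt ^^ k) (\<lambda>s. w s $ j))" for j k
  proof -
    let ?f = "\<lambda>s. w s $ j"
    obtain p where "p \<noteq> 0" "\<And>t. poly_ddt p ?f t = 0"
      using scalar_equations[of j] assms by blast
    then have *: "exp_type_derivs (\<lambda>m. (ddt ^^ m) ?f)"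
      by (intro exp_type_derivs_if_poly_ddt[OF smooth_component[OF w]])
    \<comment> \<open>Starting the derivative sequence at order \<open>k\<close> only enlarges the
      constant by \<open>M ^ k\<close>.\<close>
    have "exp_type_derivs (\<lambda>m. (ddt ^^ (m + k)) ?f)"
      unfolding exp_type_derivs_def
    proof (intro conjI allI)
      show "((ddt ^^ (m + k)) ?f has_real_derivative (ddt ^^ (Suc m + k)) ?f t) (at t)" for m t
        using * unfolding exp_type_derivs_def by (metis add_Suc)
      fix T
      obtain C M where CM: "C \<ge> 0" "M \<ge> 0" "\<And>m s. \<bar>s\<bar> \<le> T \<Longrightarrow> \<bar>(ddt ^^ m) ?f s\<bar> \<le> C * M ^ m"
        using * unfolding exp_type_derivs_def by meson
      have "\<bar>(ddt ^^ (m + k)) ?f s\<bar> \<le> (C * M ^ k) * M ^ m" if "\<bar>s\<bar> \<le> T" for m s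
        using CM(3)[OF that, of "m + k"] by (simp add: power_add algebra_simps)
      then show "\<exists>C\<ge>0. \<exists>M\<ge>0. \<forall>m t. \<bar>t\<bar> \<le> T \<longrightarrow> \<bar>(ddt ^^ (m + k)) ?f t\<bar> \<le> C * M ^ m"
        using CM(1,2) by (intro exI[of _ "C * M ^ k"] exI[of _ M] conjI) auto
    qed
    then show ?thesis
      unfolding exp_type_def by (intro exI[of _ "\<lambda>m. (ddt ^^ (m + k)) ?f"]) auto
  qed
  then show ?thesis by (intro exp_type_bilinear_df w)
qed

text \<open>The functionals are the initial values at time 0 of component \<open>j\<close> of order
  below the degree of its scalar equation; they supply the finite dimensionality needed for the
  Riesz representation.\<close>

lemma finite_separating_functionals:
  obtains F where "finite F" and "\<forall>L\<in>F. functional_on (solutions S) L"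
    and "\<forall>w\<in>solutions S. (\<forall>L\<in>F. L w = 0) \<longrightarrow> w = (\<lambda>t. 0)"
proof -
  obtain p where p: "\<And>j. p j \<noteq> 0" "\<And>j w t. w \<in> solutions S \<Longrightarrow> poly_ddt (p j) (\<lambda>s. w s $ j) t = 0"
    using scalar_equations by metis
  define F :: "((real \<Rightarrow> real ^ 'q) \<Rightarrow> real) set"
    where "F = (\<Union>j. (\<lambda>k w. (ddt ^^ k) w 0 $ j) ` {..<degree (p j)})"
  have "finite F" by (simp add: F_def)
  moreover have "\<forall>L\<in>F. functional_on (solutions S) L"
    by (auto simp: F_def functional_on_def iterated_ddt_lincomb solutions_smooth)
  moreover have "w = (\<lambda>t. 0)" if w: "w \<in> solutions S" and 0: "\<forall>L\<in>F. L w = 0" for w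
  proof -
    note sm = solutions_smooth[OF w]
    have "w t $ j = 0" for t j
    proof (rule poly_ddt_initial_value_unique[OF smooth_component[OF sm] p(1) p(2)[OF w]])
      show "(ddt ^^ k) (\<lambda>s. w s $ j) 0 = 0" if "k < degree (p j)" for k
        unfolding iterated_ddt_component[OF sm] by (rule bspec[OF 0]) (use that in \<open>auto simp: F_def\<close>)
    qed
    then show ?thesis by (simp add: fun_eq_iff vec_eq_iff)
  qed
  ultimately show ?thesis using that by simp
qed

text \<open>Evaluation of a component at 0 is represented by some \<open>r\<close>, and
  Cauchy-Schwarz bounds it with constant \<open>b r r\<close>. Applying this to shifts of
  \<open>w\<close> makes the constant independent of time.\<close>

lemma component_bound:
  assumes b: "definite_form_on (solutions S) b"
  shows "\<exists>C. \<forall>w\<in>solutions S. \<forall>t. (w t $ j)\<^sup>2 \<le> C * b (\<lambda>s. w (s + t)) (\<lambda>s. w (s + t))"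
proof -
  obtain F where F: "finite F" "\<forall>L\<in>F. functional_on (solutions S) L"
    "\<forall>w\<in>solutions S. (\<forall>L\<in>F. L w = 0) \<longrightarrow> w = (\<lambda>t. 0)"
    by (rule finite_separating_functionals)
  have "functional_on (solutions S) (\<lambda>w. w 0 $ j)"
    by (simp add: functional_on_def)
  then obtain r where r: "r \<in> solutions S" "\<And>w. w \<in> solutions S \<Longrightarrow> w 0 $ j = b r w"
    using functional_on_representation[OF F fun_subspace_solutions b, of "\<lambda>w. w 0 $ j"] by blast
  have "(w t $ j)\<^sup>2 \<le> b r r * b (\<lambda>s. w (s + t)) (\<lambda>s. w (s + t))" if "w \<in> solutions S" for w t
    using definite_form_on_Cauchy_Schwarz[OF fun_subspace_solutions b r(1) solutions_shift[OF that]]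
      r(2)[OF solutions_shift[OF that, of t]] by simp
  then show ?thesis by blast
qed

text \<open>Averaging the two orders of the arguments makes the form symmetric and keeps
  \<open>V\<close> on the diagonal.\<close>

definition polar :: "(real \<Rightarrow> real ^ 'q) \<Rightarrow> (real \<Rightarrow> real ^ 'q) \<Rightarrow> real \<Rightarrow> real" where
  "polar u v t = (bilinear_df N A u v t + bilinear_df N A v u t) / 2"

lemma polar_linear:
  assumes "w \<in> solutions S" "u \<in> solutions S" "v \<in> solutions S"
  shows "polar w (\<lambda>t. a *\<^sub>R u t + b *\<^sub>R v t) t = a * polar w u t + b * polar w v t"
  using assms by (simp add: polar_def bilinear_df_left_linear bilinear_df_right_linear
      solutions_smooth field_simps)

lemma polar_commute: "polar u v t = polar v u t"
  by (simp add: polar_def)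

lemma polar_same: "polar w w t = V w t"
  by (simp add: polar_def)

lemma V_shift: "w \<in> solutions S \<Longrightarrow> V (\<lambda>s. w (s + h)) t = V w (t + h)"
  by (rule bilinear_df_shift) (auto dest: solutions_smooth)

lemma stable: "stable_behavior (solutions S)"
proof -
  have "definite_form_on (solutions S) (\<lambda>u v. polar u v 0)"
    unfolding definite_form_on_def
  proof (intro conjI ballI impI)
    fix w assume w: "w \<in> solutions S"
    show "functional_on (solutions S) (\<lambda>v. polar w v 0)"
      using w by (simp add: functional_on_def polar_linear)
    show "0 \<le> polar w w 0" using V_nonneg[OF w] by (simp add: polar_same)
    assume "polar w w 0 = 0"
    \<comment> \<open>After a zero at time 0, monotonicity and nonnegativity force zero on an
      interval, and analyticity extends this to all times.\<close>
    then have "V w t = 0" if "0 < t" "t < 1" for t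
      using V_antimono[OF w, of 0 t] V_nonneg[OF w, of t] that by (simp add: polar_same)
    then have "V w t = 0" for t
      using exp_type_identity[OF exp_type_V[OF w], of 0 1 0] by simp
    then show "w = (\<lambda>t. 0)" using V_definite[OF w] by blast
  qed (rule polar_commute)
  from component_bound[OF this] obtain C where
    C: "\<And>j w t. w \<in> solutions S \<Longrightarrow> (w t $ j)\<^sup>2 \<le> C j * V w t"
    by (simp add: polar_same V_shift) metis
  have "bounded (w ` {0..})" if w: "w \<in> solutions S" for w
  proof (rule boundedI)
    fix x assume "x \<in> w ` {0..}"
    then obtain t where t: "x = w t" "t \<ge> 0" by auto
    \<comment> \<open>The absolute value is taken because the sign of \<open>C j\<close> is not
      recorded, and monotonicity of \<open>V\<close> is to be multiplied by it.\<close>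
    have "\<bar>w t $ j\<bar> \<le> sqrt (\<bar>C j\<bar> * V w 0)" for j
    proof (rule real_le_rsqrt)
      have "(w t $ j)\<^sup>2 \<le> \<bar>C j\<bar> * V w t"
        using C[OF w, of t j] mult_right_mono[OF abs_ge_self V_nonneg[OF w, of t], of "C j"] by simp
      also have "\<dots> \<le> \<bar>C j\<bar> * V w 0"
        using V_antimono[OF w t(2)] by (intro mult_left_mono) auto
      finally show "\<bar>w t $ j\<bar>\<^sup>2 \<le> \<bar>C j\<bar> * V w 0" by simp
    qed
    then have "(\<Sum>j\<in>UNIV. \<bar>w t $ j\<bar>) \<le> (\<Sum>j\<in>UNIV. sqrt (\<bar>C j\<bar> * V w 0))"
      by (rule sum_mono)
    then show "norm x \<le> (\<Sum>j\<in>UNIV. sqrt (\<bar>C j\<bar> * V w 0))"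
      using norm_le_l1_cart[of "w t"] t(1) by simp
  qed
  then show ?thesis
    using autonomous_solutions by (simp add: stable_behavior_def)
qed

text \<open>The loss of \<open>V\<close> over a unit of time is definite: if it is zero,
  \<open>V\<close> is constant on the interval, hence everywhere. It bounds the squared components
  and tends to 0 because \<open>V\<close> converges.\<close>

lemma asymptotically_stable:
  assumes strict: "\<And>w c. w \<in> solutions S \<Longrightarrow> (\<And>t. V w t = c) \<Longrightarrow> w = (\<lambda>t. 0)"
  shows "asymptotically_stable (solutions S)"
proof -
  have "definite_form_on (solutions S) (\<lambda>u v. polar u v 0 - polar u v 1)"
    unfolding definite_form_on_def
  proof (intro conjI ballI impI)
    fix w assume w: "w \<in> solutions S"
    show "functional_on (solutions S) (\<lambda>v. polar w v 0 - polar w v 1)"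
      using w by (simp add: functional_on_def polar_linear algebra_simps)
    show "0 \<le> polar w w 0 - polar w w 1" using V_antimono[OF w, of 0 1] by (simp add: polar_same)
    assume "polar w w 0 - polar w w 1 = 0"
    then have const: "V w t = V w 0" if "0 < t" "t < 1" for t
      using V_antimono[OF w, of 0 t] V_antimono[OF w, of t 1] that by (simp add: polar_same)
    have "V w t = V w 0" for t
      by (rule exp_type_identity[OF exp_type_V[OF w] zero_less_one const])
    then show "w = (\<lambda>t. 0)" by (rule strict[OF w])
  qed (simp add: polar_commute)
  from component_bound[OF this] obtain C where
    C: "\<And>j w t. w \<in> solutions S \<Longrightarrow> (w t $ j)\<^sup>2 \<le> C j * (V w t - V w (1 + t))"
    by (simp add: polar_same V_shift) metis
  have "(w \<longlongrightarrow> 0) at_top" if w: "w \<in> solutions S" for w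
  proof -
    \<comment> \<open>A nonincreasing function bounded below converges to its infimum.\<close>
    define c where "c = Inf (range (V w))"
    have bdd: "bdd_below (range (V w))"
      using V_nonneg[OF w] by (auto intro: bdd_belowI[of _ 0])
    have lim: "(V w \<longlongrightarrow> c) at_top"
    proof (rule order_tendstoI)
      fix a assume "a < c"
      moreover have "c \<le> V w t" for t
        unfolding c_def by (rule cINF_lower[OF bdd]) simp
      ultimately have "a < V w t" for t by (rule less_le_trans)
      then show "\<forall>\<^sub>F t in at_top. a < V w t" by simp
    next
      fix a assume "c < a"
      then obtain s where "V w s < a"
        unfolding c_def using cINF_less_iff[OF _ bdd, of a] by blast
      then have "V w t < a" if "s \<le> t" for t
        using V_antimono[OF w that] by simp
      then show "\<forall>\<^sub>F t in at_top. V w t < a"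
        unfolding eventually_at_top_linorder by blast
    qed
    have "((\<lambda>t. V w (1 + t)) \<longlongrightarrow> c) at_top"
      by (rule filterlim_compose[OF lim]) (rule filterlim_tendsto_add_at_top[OF tendsto_const filterlim_ident])
    then have "((\<lambda>t. C j * (V w t - V w (1 + t))) \<longlongrightarrow> C j * (c - c)) at_top" for j
      by (intro tendsto_intros lim)
    then have bound_lim: "((\<lambda>t. C j * (V w t - V w (1 + t))) \<longlongrightarrow> 0) at_top" for j
      by simp
    have "((\<lambda>t. (w t $ j)\<^sup>2) \<longlongrightarrow> 0) at_top" for j
      by (rule tendsto_sandwich[OF _ _ tendsto_const bound_lim[of j]])
        (rule always_eventually, rule allI, rule zero_le_power2 C[OF w])+
    then have "((\<lambda>t. sqrt ((w t $ j)\<^sup>2)) \<longlongrightarrow> sqrt 0) at_top" for j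
      by (rule tendsto_real_sqrt)
    then have "((\<lambda>t. w t $ j) \<longlongrightarrow> 0 $ j) at_top" for j
      by (simp add: tendsto_rabs_zero_iff)
    then show ?thesis by (rule vec_tendstoI)
  qed
  then show ?thesis
    using autonomous_solutions by (simp add: asymptotically_stable_def)
qed

end

section \<open>The Lyapunov function built from the storage functions\<close>

theorem theorem4:
  fixes B1 B2 B :: "(real \<Rightarrow> real ^ 'q) set"
    and \<Phi>1 \<Phi>2 \<Psi>1 \<Psi>2 \<Gamma> :: "'q::finite poly2_mat"
    and \<alpha>1 \<alpha>2 :: real
  assumes "B1 \<in> linear_behaviors" and "B2 \<in> linear_behaviors"
    and "symmetric2 \<Phi>1" and "symmetric2 \<Phi>2"
    and "symmetric2 \<Psi>1" and "storage_function B1 \<Phi>1 \<Psi>1"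
    and "symmetric2 \<Psi>2" and "storage_function B2 \<Phi>2 \<Psi>2"
    and "B = B1 \<inter> B2"
    and "\<alpha>1 > 0" and "\<alpha>2 \<ge> 0"
    and "symmetric2 \<Gamma>"
    and "le_on B (\<lambda>w t. \<alpha>1 * QDF \<Phi>1 w t + \<alpha>2 * QDF \<Phi>2 w t) (ddt_map (QDF \<Gamma>))"
  shows "(pos_on B (\<lambda>w t. \<alpha>1 * QDF \<Psi>1 w t + \<alpha>2 * QDF \<Psi>2 w t - QDF \<Gamma> w t)
            \<longrightarrow> stable_behavior B) \<and>
         (strictly_dissipative B1 \<Phi>1 \<Psi>1 \<and>
          nonneg_on B (\<lambda>w t. \<alpha>1 * QDF \<Psi>1 w t + \<alpha>2 * QDF \<Psi>2 w t - QDF \<Gamma> w t)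
            \<longrightarrow> asymptotically_stable B)"
proof -
  obtain S where S: "B = solutions S"
    using linear_behaviors_Int assms(1,2,9) by blast
  obtain n1 n2 n3 where n: "\<And>N w. N \<ge> n1 \<Longrightarrow> QDF \<Psi>1 w = bilinear_df N (coeff2 \<Psi>1) w w"
    "\<And>N w. N \<ge> n2 \<Longrightarrow> QDF \<Psi>2 w = bilinear_df N (coeff2 \<Psi>2) w w"
    "\<And>N w. N \<ge> n3 \<Longrightarrow> QDF \<Gamma> w = bilinear_df N (coeff2 \<Gamma>) w w"
    using QDF_eq_bilinear_df[of \<Psi>1] QDF_eq_bilinear_df[of \<Psi>2] QDF_eq_bilinear_df[of \<Gamma>] by blast
  \<comment> \<open>The sum is at least each of the three thresholds, so one range serves all three
    forms.\<close>
  define N where "N = n1 + n2 + n3"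
  define A where "A k l = \<alpha>1 *\<^sub>R coeff2 \<Psi>1 k l + \<alpha>2 *\<^sub>R coeff2 \<Psi>2 k l - coeff2 \<Gamma> k l" for k l
  let ?V = "\<lambda>w t. \<alpha>1 * QDF \<Psi>1 w t + \<alpha>2 * QDF \<Psi>2 w t - QDF \<Gamma> w t"
  let ?dV = "\<lambda>w t. \<alpha>1 * ddt_map (QDF \<Psi>1) w t + \<alpha>2 * ddt_map (QDF \<Psi>2) w t - ddt_map (QDF \<Gamma>) w t"
  have V: "bilinear_df N A w w t = ?V w t" for w t
    using n(1)[of N w] n(2)[of N w] n(3)[of N w]
    by (simp add: N_def A_def bilinear_df_def matrix_vector_mult_add_rdistrib
        matrix_vector_mult_diff_rdistrib scaleR_matrix_vector_assoc[symmetric]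
        inner_add_right inner_diff_right sum.distrib sum_subtractf sum_distrib_left)
  have deriv: "(?V w has_real_derivative ?dV w t) (at t)" if "w \<in> B" for w t
  proof -
    have "smooth w" using that S solutions_smooth by blast
    then show ?thesis
      by (intro DERIV_diff DERIV_add DERIV_cmult QDF_differentiable)
  qed
  \<comment> \<open>The storage inequality for \<open>\<Psi>2\<close> and the hypothesis on
    \<open>\<Gamma>\<close> cancel the \<open>\<Phi>2\<close> terms; what remains is the dissipation
    slack of the first system.\<close>
  have dV: "?dV w t \<le> - \<alpha>1 * (QDF \<Phi>1 w t - ddt_map (QDF \<Psi>1) w t)" if "w \<in> B" for w t
  proof -
    have "\<alpha>2 * ddt_map (QDF \<Psi>2) w t \<le> \<alpha>2 * QDF \<Phi>2 w t"
      using assms(8,9,11) that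
      by (intro mult_left_mono) (auto simp: storage_function_def le_on_def nonneg_on_def)
    moreover have "\<alpha>1 * QDF \<Phi>1 w t + \<alpha>2 * QDF \<Phi>2 w t \<le> ddt_map (QDF \<Gamma>) w t"
      using assms(13) that by (auto simp: le_on_def nonneg_on_def)
    ultimately show ?thesis by (simp add: algebra_simps)
  qed
  have diss: "0 \<le> QDF \<Phi>1 w t - ddt_map (QDF \<Psi>1) w t" if "w \<in> B" for w t
    using assms(6,9) that by (auto simp: storage_function_def le_on_def nonneg_on_def)
  have anti: "?V w t \<le> ?V w s" if w: "w \<in> B" and "s \<le> t" for w s t
  proof (rule DERIV_nonpos_imp_nonincreasing[OF \<open>s \<le> t\<close>])
    fix x
    have "0 \<le> \<alpha>1 * (QDF \<Phi>1 w x - ddt_map (QDF \<Psi>1) w x)"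
      using diss[OF w] assms(10) by simp
    then have "?dV w x \<le> 0" using dV[OF w, of x] by linarith
    then show "\<exists>y. (?V w has_real_derivative y) (at x) \<and> y \<le> 0"
      using deriv[OF w] by blast
  qed
  have "stable_behavior B" if "pos_on B ?V"
  proof -
    interpret lyapunov S N A
      by unfold_locales (use that anti in \<open>auto simp: V S pos_on_def nonneg_on_def\<close>)
    show ?thesis unfolding S by (rule stable)
  qed
  moreover have "asymptotically_stable B" if "strictly_dissipative B1 \<Phi>1 \<Psi>1" "nonneg_on B ?V"
  proof -
    \<comment> \<open>A constant \<open>V\<close> has zero derivative, which forces the slack of the
      first system to vanish, and strictness gives the zero trajectory. The case
      \<open>c = 0\<close> supplies \<open>V_definite\<close>; the general case is the assumption
      for asymptotic stability.\<close>
    have strict: "w = (\<lambda>t. 0)" if w: "w \<in> B" and const: "\<And>t. ?V w t = c" for w c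
    proof -
      have "QDF \<Phi>1 w t - ddt_map (QDF \<Psi>1) w t = 0" for t
      proof -
        have "?V w = (\<lambda>t. c)" using const by auto
        then have "?dV w t = 0"
          using deriv[OF w, of t] DERIV_const DERIV_unique by metis
        then have "\<alpha>1 * (QDF \<Phi>1 w t - ddt_map (QDF \<Psi>1) w t) \<le> 0"
          using dV[OF w, of t] by linarith
        then show ?thesis
          using diss[OF w, of t] assms(10) by (simp add: mult_le_0_iff)
      qed
      moreover have "w \<in> B1" using w assms(9) by blast
      ultimately show ?thesis
        using \<open>strictly_dissipative B1 \<Phi>1 \<Psi>1\<close>
        by (auto simp: strictly_dissipative_def less_on_def pos_on_def)
    qed
    interpret lyapunov S N A
      by unfold_locales (use that anti strict in \<open>auto simp: V S nonneg_on_def\<close>)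
    show ?thesis
      unfolding S by (rule asymptotically_stable) (use strict in \<open>auto simp: V S\<close>)
  qed
  ultimately show ?thesis by blast
qed

end
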